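(* Let $\{M_0(t)\}_{t\ge0}$ and $\{M(t)\}_{t\ge0}$ be independent generalized counting processes with positive rates $\mu_1,\dots,\mu_{k_0}$ and $\lambda_1,\dots,\lambda_k$, respectively, and let $\hat M(t)=M(M_0(t))$, $t\ge0$. Let $X_1,X_2,\dots$ be independent and identically distributed random variables, independent of $\{M_0(t)\}_{t\ge0}$, such that $X_1\overset{d}{=}M(1)$. Then, for every $t\ge0$, $$\hat M(t)\overset{d}{=}\sum_{n=1}^{M_0(t)}X_n .$$
   Context: A generalized counting process (GCP) $\{M(t)\}_{t\ge0}$ with positive rates $\lambda_1,\dots,\lambda_k$ is a right-continuous $\mathbb{N}_0$-valued process ($\mathbb{N}_0=\{0,1,2,\dots\}$) with $M(0)=0$ and stationary independent increments, whose probability generating function is $\mathbb{E}(u^{M(t)})=\exp\big(-t\sum_{j=1}^{k}\lambda_j(1-u^j)\big)$, $|u|\le1$. The process $\hat M(t)=M(M_0(t))$ is called the iterated generalized counting process (IGCP). The symbol $\overset{d}{=}$ denotes equality in distribution; an empty sum is $0$. *)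

theory Defs
  imports "HOL-Probability.Probability"
begin

text \<open>
  Increments are taken in \<^typ>\<open>int\<close>, since subtraction on \<^typ>\<open>nat\<close> truncates and
  monotonicity of the paths is not assumed. Path properties are required almost surely only.
\<close>

locale generalized_counting_process = prob_space P
  for P :: "'a measure" +
  fixes k :: nat and rate :: "nat \<Rightarrow> real" and M :: "real \<Rightarrow> 'a \<Rightarrow> nat"
  assumes k_pos: "1 \<le> k"
    and rate_pos: "\<And>j. j \<in> {1..k} \<Longrightarrow> 0 < rate j"
    and measurable_process: "\<And>t. 0 \<le> t \<Longrightarrow> M t \<in> measurable P (count_space UNIV)"
    and right_continuous: "AE \<omega> in P. \<forall>t\<ge>0. continuous (at_right t) (\<lambda>s. M s \<omega>)"
    and start_zero: "AE \<omega> in P. M 0 \<omega> = 0"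
    and stationary_increments:
      "\<And>s h. \<lbrakk>0 \<le> s; 0 \<le> h\<rbrakk> \<Longrightarrow>
         distr P (count_space UNIV) (\<lambda>\<omega>. int (M (s + h) \<omega>) - int (M s \<omega>)) =
         distr P (count_space UNIV) (\<lambda>\<omega>. int (M h \<omega>) - int (M 0 \<omega>))"
    and independent_increments:
      "\<And>(n::nat) (\<tau> :: nat \<Rightarrow> real). \<lbrakk>0 \<le> \<tau> 0; \<And>i. i < n \<Longrightarrow> \<tau> i \<le> \<tau> (Suc i)\<rbrakk> \<Longrightarrow>
         indep_vars (\<lambda>_. count_space UNIV)
           (\<lambda>i \<omega>. int (M (\<tau> (Suc i)) \<omega>) - int (M (\<tau> i) \<omega>)) {..<n}"
    and pgf: "\<And>(t::real) (u::real). \<lbrakk>0 \<le> t; \<bar>u\<bar> \<le> 1\<rbrakk> \<Longrightarrow>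
         expectation (\<lambda>\<omega>. u ^ M t \<omega>) = exp (- t * (\<Sum>j=1..k. rate j * (1 - u ^ j)))"

definition iterated_process ::
    "(real \<Rightarrow> 'a \<Rightarrow> nat) \<Rightarrow> (real \<Rightarrow> 'a \<Rightarrow> nat) \<Rightarrow> real \<Rightarrow> 'a \<Rightarrow> nat" where
  "iterated_process M M0 t \<omega> = M (real (M0 t \<omega>)) \<omega>"

definition family_sigma :: "'a measure \<Rightarrow> 'i set \<Rightarrow> ('i \<Rightarrow> 'a \<Rightarrow> nat) \<Rightarrow> 'a set set" where
  "family_sigma P I X = sigma_sets (space P) {X i -` A \<inter> space P | i A. i \<in> I}"

text \<open>
  Independence of two families as a whole. The library's \<^const>\<open>prob_space.indep_var\<close> does
  not apply because the index types may differ; \<^const>\<open>prob_space.indep_set\<close> also forces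
  both sigma-algebras to consist of events.
\<close>

definition indep_families ::
    "'a measure \<Rightarrow> 'i set \<Rightarrow> ('i \<Rightarrow> 'a \<Rightarrow> nat) \<Rightarrow> 'j set \<Rightarrow> ('j \<Rightarrow> 'a \<Rightarrow> nat) \<Rightarrow> bool" where
  "indep_families P I X J Y \<longleftrightarrow>
     prob_space.indep_set P (family_sigma P I X) (family_sigma P J Y)"

text \<open>
  Measurability is part of the definition because \<^const>\<open>distr\<close> is meaningless for
  functions that are not measurable.
\<close>

definition eq_in_distribution :: "'a measure \<Rightarrow> ('a \<Rightarrow> nat) \<Rightarrow> ('a \<Rightarrow> nat) \<Rightarrow> bool" where
  "eq_in_distribution P Y Z \<longleftrightarrow>
     Y \<in> measurable P (count_space UNIV) \<and> Z \<in> measurable P (count_space UNIV) \<and>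
     distr P (count_space UNIV) Y = distr P (count_space UNIV) Z"

end

theory Submission
  imports Defs
begin

text \<open>
  Conditioning on the value of \<open>M0 t\<close> reduces the claim to the equality in distribution of
  \<open>M n\<close> and \<open>X 1 + \<dots> + X n\<close> for every natural number \<open>n\<close>. Both have the probability
  generating function \<open>u \<mapsto> exp (- n * (\<Sum>j=1..k. lam j * (1 - u ^ j)))\<close>, which determines the
  distribution because the coefficients of a power series are unique.
\<close>

text \<open>Strong induction on \<open>k\<close>: once the coefficients below \<open>k\<close>
  vanish, dividing the series by \<open>x ^ k\<close> leaves a power series with constant term
  \<open>a k\<close> that still sums to 0 for small nonzero \<open>x\<close>.\<close>

lemma powser_sums_0_imp_coeff_0:
  fixes a :: "nat \<Rightarrow> real"
  assumes s: "0 < s" and sums: "\<And>x. \<bar>x\<bar> < s \<Longrightarrow> (\<lambda>n. a n * x ^ n) sums 0"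
  shows "a k = 0"
proof (induction k rule: less_induct)
  case (less k)
  have "(\<lambda>n. a (n + k) * x ^ n) sums 0" if "x \<noteq> 0" "norm x < s" for x
  proof -
    have "(\<lambda>n. a (n + k) * x ^ (n + k)) sums 0"
      using sums_iff_shift[of "\<lambda>n. a n * x ^ n" k 0] sums[of x] that less by simp
    then have "(\<lambda>n. a (n + k) * x ^ (n + k) / x ^ k) sums (0 / x ^ k)"
      by (rule sums_divide)
    with that show ?thesis
      by (simp add: power_add)
  qed
  \<comment> \<open>The sum of the shifted series tends to its constant term \<open>a k\<close> at
    the punctured point 0, while it is constantly 0 there.\<close>
  from powser_limit_0_strong[OF s this] show ?case
    using tendsto_unique[OF _ tendsto_const, of "at (0::real)" "0::real"] by force
qed

context prob_space
begin

lemma distr_nat_eqI: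
  fixes Y Z :: "'a \<Rightarrow> nat"
  assumes Y: "random_variable (count_space UNIV) Y"
    and Z: "random_variable (count_space UNIV) Z"
    and eq: "\<And>m. prob {\<omega> \<in> space M. Y \<omega> = m} = prob {\<omega> \<in> space M. Z \<omega> = m}"
  shows "distr M (count_space UNIV) Y = distr M (count_space UNIV) Z"
proof (rule measure_eqI_countable[where A = UNIV])
  fix m :: nat
  have "Y -` {m} \<inter> space M = {\<omega> \<in> space M. Y \<omega> = m}" "Z -` {m} \<inter> space M = {\<omega> \<in> space M. Z \<omega> = m}"
    by auto
  with eq show "emeasure (distr M (count_space UNIV) Y) {m} =
      emeasure (distr M (count_space UNIV) Z) {m}"
    by (simp add: emeasure_distr[OF Y] emeasure_distr[OF Z] emeasure_eq_measure)
qed auto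

lemma prob_sums_partition_nat:
  fixes N :: "'a \<Rightarrow> nat"
  assumes N: "random_variable (count_space UNIV) N" and A: "A \<in> events"
  shows "(\<lambda>n. prob ({\<omega> \<in> space M. N \<omega> = n} \<inter> A)) sums prob A"
proof -
  let ?B = "\<lambda>n. {\<omega> \<in> space M. N \<omega> = n} \<inter> A"
  have [measurable]: "N \<in> measurable M (count_space UNIV)" "A \<in> sets M"
    by fact+
  have "(\<Union>n. ?B n) = A"
    using sets.sets_into_space[OF A] by auto
  moreover have "(\<lambda>n. prob (?B n)) sums prob (\<Union>n. ?B n)"
    by (rule measure_UNION) (auto simp: disjoint_family_on_def)
  ultimately show ?thesis
    by simp
qed

text \<open>Pointwise, \<open>u ^ Y\<close> is a series of weighted indicators of the level sets
  with a single nonzero term. Expectation and sum may be interchanged because the integrals of the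
  absolute values are summable.\<close>

lemma pgf_sums:
  fixes Y :: "'a \<Rightarrow> nat" and u :: real
  assumes Y: "random_variable (count_space UNIV) Y" and u: "\<bar>u\<bar> \<le> 1"
  shows "(\<lambda>n. prob {\<omega> \<in> space M. Y \<omega> = n} * u ^ n) sums expectation (\<lambda>\<omega>. u ^ Y \<omega>)"
proof -
  let ?A = "\<lambda>n. {\<omega> \<in> space M. Y \<omega> = n}"
  let ?f = "\<lambda>n \<omega>. indicator (?A n) \<omega> * u ^ n :: real"
  have [measurable]: "Y \<in> measurable M (count_space UNIV)"
    by fact
  have int: "integrable M (?f n)" for n
    by (intro integrable_mult_left integrable_real_indicator) (auto simp: less_top[symmetric])
  have point: "(\<lambda>n. ?f n \<omega>) sums (u ^ Y \<omega>)" "(\<lambda>n. norm (?f n \<omega>)) sums norm (u ^ Y \<omega>)"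
    if "\<omega> \<in> space M" for \<omega>
  proof -
    have eq: "(\<lambda>n. ?f n \<omega>) = (\<lambda>n. if n = Y \<omega> then u ^ n else 0)"
      using that by (auto simp: indicator_def)
    show "(\<lambda>n. ?f n \<omega>) sums (u ^ Y \<omega>)"
      unfolding eq by (rule sums_single)
    have eq': "(\<lambda>n. norm (?f n \<omega>)) = (\<lambda>n. if n = Y \<omega> then norm (u ^ n) else 0)"
      using that by (auto simp: indicator_def)
    show "(\<lambda>n. norm (?f n \<omega>)) sums norm (u ^ Y \<omega>)"
      unfolding eq' by (rule sums_single)
  qed
  \<comment> \<open>Partitioning the whole space by the values of \<open>Y\<close> yields the
    summable majorant for the comparison test; the factor \<open>u ^ n\<close> is at most 1 in
    absolute value.\<close>
  have "summable (\<lambda>n. prob (?A n \<inter> space M))"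
    using prob_sums_partition_nat[OF Y sets.top] by (rule sums_summable)
  then have "summable (\<lambda>n. prob (?A n))"
    by (simp add: Int_absorb2)
  then have summable_int: "summable (\<lambda>n. \<integral>\<omega>. norm (?f n \<omega>) \<partial>M)"
  proof (rule summable_comparison_test_ev[rotated], intro always_eventually allI)
    fix n
    have "(\<integral>\<omega>. norm (?f n \<omega>) \<partial>M) = prob (?A n) * \<bar>u\<bar> ^ n"
      by (simp add: abs_mult power_abs)
    also have "\<dots> \<le> prob (?A n)"
      using u by (intro mult_left_le power_le_one) auto
    finally show "norm (\<integral>\<omega>. norm (?f n \<omega>) \<partial>M) \<le> prob (?A n)"
      by simp
  qed
  have AE: "AE \<omega> in M. summable (\<lambda>n. norm (?f n \<omega>))"
    using point(2) by (intro AE_I2) (rule sums_summable)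
  have "(\<Sum>n. integral\<^sup>L M (?f n)) = expectation (\<lambda>\<omega>. \<Sum>n. ?f n \<omega>)"
    using integral_suminf[OF int AE summable_int] by simp
  also have "\<dots> = expectation (\<lambda>\<omega>. u ^ Y \<omega>)"
    using point(1) by (intro Bochner_Integration.integral_cong refl) (simp add: sums_iff)
  finally have "(\<lambda>n. integral\<^sup>L M (?f n)) sums expectation (\<lambda>\<omega>. u ^ Y \<omega>)"
    using summable_integral[OF int AE summable_int] by (simp add: sums_iff)
  moreover have "integral\<^sup>L M (?f n) = prob (?A n) * u ^ n" for n
    by simp
  ultimately show ?thesis
    by simp
qed

text \<open>The differences of the point masses are the coefficients of a power series that vanishes
  for \<open>\<bar>u\<bar> < 1\<close>.\<close>

lemma prob_eq_if_pgf_eq: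
  fixes Y Z :: "'a \<Rightarrow> nat"
  assumes Y: "random_variable (count_space UNIV) Y"
    and Z: "random_variable (count_space UNIV) Z"
    and eq: "\<And>u::real. \<bar>u\<bar> < 1 \<Longrightarrow> expectation (\<lambda>\<omega>. u ^ Y \<omega>) = expectation (\<lambda>\<omega>. u ^ Z \<omega>)"
  shows "prob {\<omega> \<in> space M. Y \<omega> = m} = prob {\<omega> \<in> space M. Z \<omega> = m}"
proof -
  let ?a = "\<lambda>m. prob {\<omega> \<in> space M. Y \<omega> = m} - prob {\<omega> \<in> space M. Z \<omega> = m}"
  have "?a m = 0"
  proof (rule powser_sums_0_imp_coeff_0)
    show "(\<lambda>n. ?a n * u ^ n) sums 0" if "\<bar>u\<bar> < 1" for u :: real
      using sums_diff[OF pgf_sums[OF Y, of u] pgf_sums[OF Z, of u]] eq[OF that] that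
      by (simp add: left_diff_distrib)
  qed simp
  then show ?thesis
    by simp
qed

text \<open>\<open>u\<close> to the power of a sum is a product of independent factors, each bounded
  by 1 and hence integrable.\<close>

lemma pgf_sum_indep:
  fixes X :: "'i \<Rightarrow> 'a \<Rightarrow> nat" and u :: real
  assumes I: "finite I" and X: "indep_vars (\<lambda>_. count_space UNIV) X I" and u: "\<bar>u\<bar> \<le> 1"
  shows "expectation (\<lambda>\<omega>. u ^ (\<Sum>i\<in>I. X i \<omega>)) = (\<Prod>i\<in>I. expectation (\<lambda>\<omega>. u ^ X i \<omega>))"
proof -
  have "indep_vars (\<lambda>_. borel) (\<lambda>i \<omega>. u ^ X i \<omega>) I"
    by (rule indep_vars_compose2[OF X]) simp
  moreover have "integrable M (\<lambda>\<omega>. u ^ X i \<omega>)" if "i \<in> I" for i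
  proof -
    have [measurable]: "X i \<in> measurable M (count_space UNIV)"
      using X that by (auto simp: indep_vars_def)
    show ?thesis
      using u by (intro integrable_const_bound[where B = 1]) (auto simp: power_abs intro!: AE_I2 power_le_one)
  qed
  ultimately show ?thesis
    unfolding power_sum by (rule indep_vars_lebesgue_integral[OF I])
qed

text \<open>On the event \<open>N = n\<close> the randomly indexed variable coincides with
  \<open>Y n\<close>, so the law of total probability applies. The resulting series involves the
  \<open>Y n\<close> only through their individual laws; this is why \<open>M n\<close> can be
  exchanged for a sum of \<open>n\<close> of the \<open>X i\<close> without comparing joint
  laws.\<close>

lemma random_index:
  fixes N :: "'a \<Rightarrow> nat" and Y :: "nat \<Rightarrow> 'a \<Rightarrow> nat"
  assumes N: "random_variable (count_space UNIV) N"
    and Y: "\<And>n. random_variable (count_space UNIV) (Y n)"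
    and indep: "\<And>n m. prob ({\<omega> \<in> space M. N \<omega> = n} \<inter> {\<omega> \<in> space M. Y n \<omega> = m}) =
      prob {\<omega> \<in> space M. N \<omega> = n} * prob {\<omega> \<in> space M. Y n \<omega> = m}"
  shows random_variable_random_index: "random_variable (count_space UNIV) (\<lambda>\<omega>. Y (N \<omega>) \<omega>)"
    and prob_random_index:
      "(\<lambda>n. prob {\<omega> \<in> space M. N \<omega> = n} * prob {\<omega> \<in> space M. Y n \<omega> = m}) sums
        prob {\<omega> \<in> space M. Y (N \<omega>) \<omega> = m}"
proof -
  show rv: "random_variable (count_space UNIV) (\<lambda>\<omega>. Y (N \<omega>) \<omega>)"
    using Y N by (rule measurable_compose_countable)
  then have "{\<omega> \<in> space M. Y (N \<omega>) \<omega> = m} \<in> events"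
    by measurable
  from prob_sums_partition_nat[OF N this]
  have "(\<lambda>n. prob ({\<omega> \<in> space M. N \<omega> = n} \<inter> {\<omega> \<in> space M. Y (N \<omega>) \<omega> = m})) sums
      prob {\<omega> \<in> space M. Y (N \<omega>) \<omega> = m}" .
  moreover have "{\<omega> \<in> space M. N \<omega> = n} \<inter> {\<omega> \<in> space M. Y (N \<omega>) \<omega> = m} =
      {\<omega> \<in> space M. N \<omega> = n} \<inter> {\<omega> \<in> space M. Y n \<omega> = m}" for n
    by auto
  ultimately show "(\<lambda>n. prob {\<omega> \<in> space M. N \<omega> = n} * prob {\<omega> \<in> space M. Y n \<omega> = m}) sums
      prob {\<omega> \<in> space M. Y (N \<omega>) \<omega> = m}"
    by (simp add: indep)
qed

end

text \<open>Phrasing membership in the generated sigma-algebra as measurability makes the closure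
  rules, such as the one for finite sums, available.\<close>

lemma measurable_family_sigma:
  assumes "i \<in> I"
  shows "X i \<in> measurable (sigma (space P) (family_sigma P I X)) (count_space UNIV)"
proof (rule measurableI)
  have Pow: "family_sigma P I X \<subseteq> Pow (space P)"
    unfolding family_sigma_def
    using sigma_sets_into_sp[of "{X i -` A \<inter> space P | i A. i \<in> I}" "space P"] by auto
  fix A :: "nat set"
  have "X i -` A \<inter> space P \<in> family_sigma P I X"
    unfolding family_sigma_def using assms by (intro sigma_sets.Basic) auto
  with Pow show "X i -` A \<inter> space (sigma (space P) (family_sigma P I X))
      \<in> sets (sigma (space P) (family_sigma P I X))"
    by (simp add: space_measure_of sets_measure_of sigma_sets.Basic)
qed simp

text \<open>This leads back from measurability to the events on which \<open>indep_set\<close>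
  speaks. \<open>family_sigma\<close> is already a sigma-algebra, so applying \<open>sigma\<close>
  to it adds no sets.\<close>

lemma level_set_in_family_sigma:
  assumes "Y \<in> measurable (sigma (space P) (family_sigma P I X)) (count_space UNIV)"
  shows "{\<omega> \<in> space P. Y \<omega> = m} \<in> family_sigma P I X"
proof -
  let ?G = "{X i -` A \<inter> space P | i A. i \<in> I}"
  have G: "?G \<subseteq> Pow (space P)"
    by auto
  then interpret sigma_algebra "space P" "family_sigma P I X"
    unfolding family_sigma_def by (rule sigma_algebra_sigma_sets)
  have "Y -` {m} \<inter> space P \<in> family_sigma P I X"
    using measurable_sets[OF assms, of "{m}"] space_closed
    by (simp add: space_measure_of sets_measure_of sigma_sets_eq)
  moreover have "Y -` {m} \<inter> space P = {\<omega> \<in> space P. Y \<omega> = m}"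
    by auto
  ultimately show ?thesis
    by simp
qed

theorem proposition3p1:
  fixes P :: "'a measure"
    and M0 M :: "real \<Rightarrow> 'a \<Rightarrow> nat"
    and X :: "nat \<Rightarrow> 'a \<Rightarrow> nat"
    and k0 k :: nat
    and mu lam :: "nat \<Rightarrow> real"
    and t :: real
  assumes "generalized_counting_process P k0 mu M0"
    and "generalized_counting_process P k lam M"
    and "indep_families P {0..} M0 {0..} M"
    and "prob_space.indep_vars P (\<lambda>_. count_space UNIV) X {1..}"
    and "\<And>n. 1 \<le> n \<Longrightarrow> eq_in_distribution P (X n) (X 1)"
    and "indep_families P {1..} X {0..} M0"
    and "eq_in_distribution P (X 1) (M 1)"
    and "0 \<le> t"
  shows "eq_in_distribution P (iterated_process M M0 t) (\<lambda>\<omega>. \<Sum>n=1..M0 t \<omega>. X n \<omega>)"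
proof -
  interpret prob_space P
    by (rule generalized_counting_process.axioms(1)) fact
  interpret M0: generalized_counting_process P k0 mu M0
    by fact
  interpret M: generalized_counting_process P k lam M
    by fact
  let ?S = "\<lambda>n \<omega>. \<Sum>i=1..n. X i \<omega>"
  have N: "M0 t \<in> measurable P (count_space UNIV)"
    using assms(8) by (rule M0.measurable_process)
  have Mn: "M (real n) \<in> measurable P (count_space UNIV)" for n
    by (rule M.measurable_process) simp
  have X: "X i \<in> measurable P (count_space UNIV)"
    and X_eq: "distr P (count_space UNIV) (X i) = distr P (count_space UNIV) (M 1)" if "1 \<le> i" for i
    using assms(5)[OF that] assms(7) by (auto simp: eq_in_distribution_def)
  have S: "?S n \<in> measurable P (count_space UNIV)" for n
    using X by (intro measurable_sum_nat) auto
  have pgf_X: "expectation (\<lambda>\<omega>. u ^ X i \<omega>) = exp (- (\<Sum>j=1..k. lam j * (1 - u ^ j)))"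
    if "1 \<le> i" "\<bar>u\<bar> \<le> 1" for i and u :: real
  proof -
    \<comment> \<open>Both sides are the integral of \<open>u ^ n\<close> against one and the same
      law on the natural numbers.\<close>
    have "expectation (\<lambda>\<omega>. u ^ X i \<omega>) = expectation (\<lambda>\<omega>. u ^ M 1 \<omega>)"
      using arg_cong[OF X_eq[OF that(1)], of "\<lambda>D. \<integral>n. u ^ n \<partial>D"] Mn[of 1]
      by (simp add: integral_distr[OF X[OF that(1)]] integral_distr)
    with that show ?thesis
      by (simp add: M.pgf)
  qed
  have dist: "prob {\<omega> \<in> space P. M (real n) \<omega> = m} = prob {\<omega> \<in> space P. ?S n \<omega> = m}" for n m
  proof (rule prob_eq_if_pgf_eq[OF Mn S])
    fix u :: real
    assume u: "\<bar>u\<bar> < 1"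
    have indep: "indep_vars (\<lambda>_. count_space UNIV) X {1..n}"
      by (rule indep_vars_subset[OF assms(4)]) auto
    have "expectation (\<lambda>\<omega>. u ^ ?S n \<omega>) = (\<Prod>i=1..n. expectation (\<lambda>\<omega>. u ^ X i \<omega>))"
      using u by (intro pgf_sum_indep indep) auto
    also have "\<dots> = (\<Prod>i=1..n. exp (- (\<Sum>j=1..k. lam j * (1 - u ^ j))))"
      using u by (intro prod.cong refl pgf_X) auto
    \<comment> \<open>The exponent in the generating function of \<open>M\<close> is linear in time,
      so \<open>n\<close> equal factors from time 1 multiply to the value at time \<open>n\<close>.
      For \<open>n = 0\<close> both sides are 1.\<close>
    also have "\<dots> = expectation (\<lambda>\<omega>. u ^ M (real n) \<omega>)"
      using u by (simp add: M.pgf exp_of_nat_mult[symmetric])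
    finally show "expectation (\<lambda>\<omega>. u ^ M (real n) \<omega>) = expectation (\<lambda>\<omega>. u ^ ?S n \<omega>)"
      by (rule sym)
  qed
  have indep_M: "indep_set (family_sigma P {0..} M0) (family_sigma P {0..} M)"
    and indep_X: "indep_set (family_sigma P {1..} X) (family_sigma P {0..} M0)"
    using assms(3,6) by (auto simp: indep_families_def)
  have N_level: "{\<omega> \<in> space P. M0 t \<omega> = n} \<in> family_sigma P {0..} M0" for n
    using assms(8) by (intro level_set_in_family_sigma measurable_family_sigma) simp
  have M_level: "{\<omega> \<in> space P. M (real n) \<omega> = m} \<in> family_sigma P {0..} M" for n m
    by (intro level_set_in_family_sigma measurable_family_sigma) simp
  \<comment> \<open>A partial sum depends on several of the \<open>X i\<close>, which is why
    independence of \<open>M0\<close> from the family as a whole is used here.\<close>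
  have S_level: "{\<omega> \<in> space P. ?S n \<omega> = m} \<in> family_sigma P {1..} X" for n m
    by (intro level_set_in_family_sigma measurable_sum_nat measurable_family_sigma) simp
  note ind_M = indep_setD[OF indep_M N_level M_level]
  have ind_S: "prob ({\<omega> \<in> space P. M0 t \<omega> = n} \<inter> {\<omega> \<in> space P. ?S n \<omega> = m}) =
      prob {\<omega> \<in> space P. M0 t \<omega> = n} * prob {\<omega> \<in> space P. ?S n \<omega> = m}" for n m
    using indep_setD[OF indep_X S_level N_level] by (simp add: Int_commute mult.commute)
  have rv_M: "(\<lambda>\<omega>. M (real (M0 t \<omega>)) \<omega>) \<in> measurable P (count_space UNIV)"
    using N Mn ind_M by (rule random_variable_random_index)
  have rv_S: "(\<lambda>\<omega>. ?S (M0 t \<omega>) \<omega>) \<in> measurable P (count_space UNIV)"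
    using N S ind_S by (rule random_variable_random_index)
  have "distr P (count_space UNIV) (\<lambda>\<omega>. M (real (M0 t \<omega>)) \<omega>) =
      distr P (count_space UNIV) (\<lambda>\<omega>. ?S (M0 t \<omega>) \<omega>)"
  proof (rule distr_nat_eqI[OF rv_M rv_S])
    fix m
    show "prob {\<omega> \<in> space P. M (real (M0 t \<omega>)) \<omega> = m} =
        prob {\<omega> \<in> space P. ?S (M0 t \<omega>) \<omega> = m}"
      \<comment> \<open>After rewriting with \<open>dist\<close>, the two total probability series
        agree term by term, hence so do their sums.\<close>
      using prob_random_index[of "M0 t" "\<lambda>n. M (real n)", OF N Mn ind_M]
        prob_random_index[of "M0 t" ?S, OF N S ind_S]
      unfolding dist by (rule sums_unique2)
  qed
  with rv_M rv_S show ?thesis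
    by (simp add: eq_in_distribution_def iterated_process_def[abs_def])
qed

end
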